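(* Let $U$ be a set, $E$ a finite set, and $G=(F,E)$ a covering soft set over $U$, with associated soft covering approximation space $S=(U,C_G)$. Then the following are equivalent: (i) $S_-(X\cap Y)=S_-(X)\cap S_-(Y)$ for all $X,Y\subseteq U$; (ii) for all $e_1,e_2\in E$, the set $F(e_1)\cap F(e_2)$ is a finite union of elements of $C_G$.
   Context: A soft set over $U$ is a pair $G=(F,E)$ with $F:E\to P(U)$ a map into the power set of $U$. It is a covering soft set if $\bigcup_{e\in E}F(e)=U$ and $F(e)\neq\emptyset$ for every $e\in E$. Write $C_G=\{F(e):e\in E\}$; the pair $S=(U,C_G)$ is called a soft covering approximation space. For $X\subseteq U$ the soft covering lower approximation is $S_-(X)=\bigcup\{F(e): e\in E,\ F(e)\subseteq X\}$. The empty union (equal to $\emptyset$) counts as a finite union of elements of $C_G$. *)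

theory Defs
  imports Main "HOL-Library.FuncSet"
begin

text \<open>
  A soft set \<open>G = (F, E)\<close> is given by a total function \<open>F\<close> and its parameter set \<open>E\<close>;
  values of \<open>F\<close> outside \<open>E\<close> are never used.
\<close>

definition soft_set :: "'a set \<Rightarrow> ('e \<Rightarrow> 'a set) \<Rightarrow> 'e set \<Rightarrow> bool" where
  "soft_set U F E \<longleftrightarrow> F \<in> E \<rightarrow> Pow U"

definition covering_soft_set :: "'a set \<Rightarrow> ('e \<Rightarrow> 'a set) \<Rightarrow> 'e set \<Rightarrow> bool" where
  "covering_soft_set U F E \<longleftrightarrow>
     soft_set U F E \<and> (\<Union>e\<in>E. F e) = U \<and> (\<forall>e\<in>E. F e \<noteq> {})"

definition soft_cover :: "('e \<Rightarrow> 'a set) \<Rightarrow> 'e set \<Rightarrow> 'a set set" where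
  "soft_cover F E = {F e | e. e \<in> E}"

definition soft_covering_lower :: "('e \<Rightarrow> 'a set) \<Rightarrow> 'e set \<Rightarrow> 'a set \<Rightarrow> 'a set" where
  "soft_covering_lower F E X = \<Union> {F e | e. e \<in> E \<and> F e \<subseteq> X}"

text \<open>The empty subfamily is allowed, so the empty set is a finite union of elements of any family.\<close>

definition finite_union_of_elements :: "'a set set \<Rightarrow> 'a set \<Rightarrow> bool" where
  "finite_union_of_elements C A \<longleftrightarrow> (\<exists>D. D \<subseteq> C \<and> finite D \<and> A = \<Union> D)"

end

(* The sets F e are fixed points of the lower approximation, so multiplicativity exhibits
   F e1 \<inter> F e2 as the lower approximation of itself, a union of members of the finite cover.
   Conversely, a point of S_-(X) \<inter> S_-(Y) lies in some F e1 \<inter> F e2 with F e1 \<subseteq> X and F e2 \<subseteq> Y,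
   hence in a member of the cover contained in F e1 \<inter> F e2. *)
theory Submission
  imports Defs
begin

lemma mem_soft_covering_lower_iff:
  "x \<in> soft_covering_lower F E X \<longleftrightarrow> (\<exists>e\<in>E. x \<in> F e \<and> F e \<subseteq> X)"
  unfolding soft_covering_lower_def by blast

lemma soft_covering_lower_member:
  assumes "e \<in> E"
  shows "soft_covering_lower F E (F e) = F e"
  using assms by (auto simp: mem_soft_covering_lower_iff)

lemma soft_covering_lower_mono:
  assumes "X \<subseteq> Y"
  shows "soft_covering_lower F E X \<subseteq> soft_covering_lower F E Y"
  using assms unfolding soft_covering_lower_def by blast

text \<open>The sets \<open>F e\<close> contained in \<open>X\<close> are the images under
  \<open>F\<close> of a subset of \<open>E\<close>, so finiteness of \<open>E\<close> makes this
  subfamily of the cover finite.\<close>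

lemma finite_union_of_elements_soft_covering_lower:
  assumes "finite E"
  shows "finite_union_of_elements (soft_cover F E) (soft_covering_lower F E X)"
  unfolding finite_union_of_elements_def soft_covering_lower_def soft_cover_def
  using assms by (intro exI[of _ "{F e | e. e \<in> E \<and> F e \<subseteq> X}"]) auto

text \<open>Each member of a family with union \<open>A\<close> is some \<open>F e\<close> with
  \<open>F e \<subseteq> A\<close>, so it takes part in the lower approximation of \<open>A\<close>;
  conversely, that approximation never leaves \<open>A\<close>.\<close>

lemma soft_covering_lower_finite_union:
  assumes "finite_union_of_elements (soft_cover F E) A"
  shows "soft_covering_lower F E A = A"
  using assms unfolding finite_union_of_elements_def soft_cover_def
  by (fastforce simp: mem_soft_covering_lower_iff)

theorem theorem20:
  fixes U :: "'a set" and E :: "'e set" and F :: "'e \<Rightarrow> 'a set"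
  assumes "finite E"
    and "covering_soft_set U F E"
  shows "(\<forall>X Y. X \<subseteq> U \<longrightarrow> Y \<subseteq> U \<longrightarrow>
            soft_covering_lower F E (X \<inter> Y) =
            soft_covering_lower F E X \<inter> soft_covering_lower F E Y) \<longleftrightarrow>
         (\<forall>e1\<in>E. \<forall>e2\<in>E.
            finite_union_of_elements (soft_cover F E) (F e1 \<inter> F e2))"
    (is "?mult \<longleftrightarrow> ?unions")
proof
  assume mult: ?mult
  show ?unions
  proof (intro ballI)
    fix e1 e2 assume e: "e1 \<in> E" "e2 \<in> E"
    \<comment> \<open>Multiplicativity is assumed for subsets of \<open>U\<close> only; it is
      applied to \<open>X = F e1\<close> and \<open>Y = F e2\<close>, both fixed by the lower
      approximation.\<close>
    then have "F e1 \<subseteq> U" "F e2 \<subseteq> U"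
      using assms(2) by (auto simp: covering_soft_set_def)
    then have "soft_covering_lower F E (F e1 \<inter> F e2) = F e1 \<inter> F e2"
      using mult e by (simp add: soft_covering_lower_member)
    then show "finite_union_of_elements (soft_cover F E) (F e1 \<inter> F e2)"
      using finite_union_of_elements_soft_covering_lower[OF assms(1)] by metis
  qed
next
  assume unions: ?unions
  show ?mult
  proof (intro allI impI equalityI subsetI)
    fix X Y x
    assume "x \<in> soft_covering_lower F E (X \<inter> Y)"
    then show "x \<in> soft_covering_lower F E X \<inter> soft_covering_lower F E Y"
      by (auto simp: mem_soft_covering_lower_iff)
  next
    fix X Y x
    assume "x \<in> soft_covering_lower F E X \<inter> soft_covering_lower F E Y"
    then obtain e1 e2 where e: "e1 \<in> E" "e2 \<in> E" "F e1 \<subseteq> X" "F e2 \<subseteq> Y"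
      and x: "x \<in> F e1 \<inter> F e2"
      by (auto simp: mem_soft_covering_lower_iff)
    \<comment> \<open>This puts \<open>x\<close> in the lower approximation of the smaller set
      \<open>F e1 \<inter> F e2\<close>; monotonicity then carries it to that of
      \<open>X \<inter> Y\<close>.\<close>
    have "soft_covering_lower F E (F e1 \<inter> F e2) = F e1 \<inter> F e2"
      using unions e by (simp add: soft_covering_lower_finite_union)
    moreover have "F e1 \<inter> F e2 \<subseteq> X \<inter> Y"
      using e by blast
    ultimately show "x \<in> soft_covering_lower F E (X \<inter> Y)"
      using x soft_covering_lower_mono by blast
  qed
qed

end
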